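(* Let $T\in\mathbb N$, $B\in\mathbb N$, $\alpha\in(0,1)$, and let $g=(g_0,\ldots,g_T)$ be a deterministic vector of positive numbers. Let $(M_t)_{0\le t\le T}$ be (the test trajectory of) an e-process under the null distribution $P_0$, and let $(M_t^{(b)})_{0\le t\le T}$, $b=1,\ldots,B$, be independent calibration trajectories of the same e-process. Suppose that, under $P_0$, the test trajectory and the $B$ calibration trajectories are exchangeable. Put $R_g^{(b)}:=\max_{0\le t\le T}M_t^{(b)}/g_t$, let $\widehat q_\alpha(g):=R_{g,(k_{\alpha,B})}$ with $k_{\alpha,B}:=\lceil(1-\alpha)(B+1)\rceil$, and let $$\nu_\alpha:=\inf\{0\le t\le T: M_t>\widehat q_\alpha(g)\,g_t\},\qquad \inf\varnothing:=\infty .$$ Then $$P_0(\nu_\alpha\le T)\le\alpha .$$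
   Context: $R_{g,(1)}\le\cdots\le R_{g,(B)}$ are the order statistics of $R_g^{(1)},\ldots,R_g^{(B)}$, with the convention $R_{g,(B+1)}:=+\infty$. An e-process under $P_0$ is a nonnegative process adapted to a filtration $(\mathcal F_t)$ with $\mathbb E_{P_0}[M_\sigma]\le1$ for every stopping time $\sigma$. Exchangeability is meant for the $B+1$ random vectors in $\mathbb R^{T+1}$ given by the trajectories. The probability $P_0$ includes the randomness of the calibration trajectories. *)

theory Defs
  imports "HOL-Probability.Probability" "HOL-Combinatorics.Permutations"
begin

text \<open>
  E-processes with time set \<open>{0..T}\<close>. The filtration is indexed by all of \<open>nat\<close>, but only
  \<open>F 0, \<dots>, F T\<close> matter, since the stopping times considered take values in \<open>{0..T}\<close>.
  The expectation is a nonnegative integral, so that \<open>\<le> 1\<close> includes integrability.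
\<close>

definition e_process ::
  "'a measure \<Rightarrow> nat \<Rightarrow> (nat \<Rightarrow> 'a measure) \<Rightarrow> (nat \<Rightarrow> 'a \<Rightarrow> real) \<Rightarrow> bool" where
  "e_process P T F M \<longleftrightarrow>
     filtration (space P) F \<and> (\<forall>t. subalgebra P (F t)) \<and>
     (\<forall>t\<le>T. M t \<in> borel_measurable (F t)) \<and>
     (\<forall>t\<le>T. \<forall>\<omega>\<in>space P. 0 \<le> M t \<omega>) \<and>
     (\<forall>\<sigma>. stopping_time F \<sigma> \<and> (\<forall>\<omega>\<in>space P. \<sigma> \<omega> \<le> T) \<longrightarrow>
        (\<integral>\<^sup>+ \<omega>. ennreal (M (\<sigma> \<omega>) \<omega>) \<partial>P) \<le> 1)"

text \<open>The space of trajectories, i.e. real vectors indexed by \<open>{0..T}\<close>, with its Borel sets.\<close>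

abbreviation traj_space :: "nat \<Rightarrow> (nat \<Rightarrow> real) measure" where
  "traj_space T \<equiv> (\<Pi>\<^sub>M t\<in>{0..T}. borel)"

definition traj :: "nat \<Rightarrow> (nat \<Rightarrow> 'a \<Rightarrow> real) \<Rightarrow> 'a \<Rightarrow> nat \<Rightarrow> real" where
  "traj T M \<omega> = (\<lambda>t\<in>{0..T}. M t \<omega>)"

definition exchangeable :: "'a measure \<Rightarrow> 'b measure \<Rightarrow> 'i set \<Rightarrow> ('i \<Rightarrow> 'a \<Rightarrow> 'b) \<Rightarrow> bool" where
  "exchangeable P N I X \<longleftrightarrow>
     (\<forall>i\<in>I. X i \<in> measurable P N) \<and>
     (\<forall>\<pi>. \<pi> permutes I \<longrightarrow>
        distr P (\<Pi>\<^sub>M i\<in>I. N) (\<lambda>\<omega>. \<lambda>i\<in>I. X (\<pi> i) \<omega>) =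
        distr P (\<Pi>\<^sub>M i\<in>I. N) (\<lambda>\<omega>. \<lambda>i\<in>I. X i \<omega>))"

definition max_ratio :: "nat \<Rightarrow> (nat \<Rightarrow> real) \<Rightarrow> (nat \<Rightarrow> 'a \<Rightarrow> real) \<Rightarrow> 'a \<Rightarrow> real" where
  "max_ratio T g M \<omega> = Max ((\<lambda>t. M t \<omega> / g t) ` {0..T})"

text \<open>
  The \<open>k\<close>-th smallest of \<open>r 1, \<dots>, r B\<close>, counted with multiplicity, for \<open>1 \<le> k \<le> B\<close>.
  The convention that the \<open>(B+1)\<close>-st order statistic is \<open>\<infinity>\<close> is built in.
\<close>

definition order_stat :: "nat \<Rightarrow> (nat \<Rightarrow> real) \<Rightarrow> nat \<Rightarrow> ereal" where
  "order_stat B r k =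
     (if k \<le> B then ereal (sort (map r [1..<B + 1]) ! (k - 1)) else \<infinity>)"

definition k_index :: "real \<Rightarrow> nat \<Rightarrow> nat" where
  "k_index \<alpha> B = nat \<lceil>(1 - \<alpha>) * real (B + 1)\<rceil>"

definition q_hat ::
  "nat \<Rightarrow> nat \<Rightarrow> real \<Rightarrow> (nat \<Rightarrow> real) \<Rightarrow> (nat \<Rightarrow> nat \<Rightarrow> 'a \<Rightarrow> real) \<Rightarrow> 'a \<Rightarrow> ereal" where
  "q_hat T B \<alpha> g Mc \<omega> = order_stat B (\<lambda>b. max_ratio T g (Mc b) \<omega>) (k_index \<alpha> B)"

text \<open>The infimum is taken in \<open>enat\<close>, where \<open>Inf {} = \<infinity>\<close>.\<close>

definition first_crossing ::
  "nat \<Rightarrow> nat \<Rightarrow> real \<Rightarrow> (nat \<Rightarrow> real) \<Rightarrow> (nat \<Rightarrow> 'a \<Rightarrow> real) \<Rightarrow>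
   (nat \<Rightarrow> nat \<Rightarrow> 'a \<Rightarrow> real) \<Rightarrow> 'a \<Rightarrow> enat" where
  "first_crossing T B \<alpha> g M Mc \<omega> =
     Inf {enat t | t. t \<le> T \<and> ereal (M t \<omega>) > q_hat T B \<alpha> g Mc \<omega> * ereal (g t)}"

end

theory Submission
  imports Defs
begin

text \<open>
  The crossing time is at most \<open>T\<close> exactly when the test statistic \<open>R\<^sub>0\<close> exceeds the \<open>k\<close>-th order
  statistic of \<open>R\<^sub>1, \<dots>, R\<^sub>B\<close>, i.e. when at least \<open>k\<close> of \<open>R\<^sub>0, \<dots>, R\<^sub>B\<close> lie strictly below \<open>R\<^sub>0\<close>.
  By exchangeability this has the same probability for every index in place of \<open>0\<close>, and at most
  \<open>B + 1 - k\<close> indices can have the property at once. Hence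
  \<open>(B + 1) P(\<nu> \<le> T) \<le> B + 1 - k \<le> \<alpha> (B + 1)\<close>.
\<close>

text \<open>Choose a qualifying index \<open>j\<close> with \<open>r j\<close> least. The at least
  \<open>k\<close> indices strictly below \<open>r j\<close> cannot qualify, by minimality, so they
  are disjoint from the qualifying ones. Strict comparison makes this work with ties too.\<close>

lemma card_rank_ge:
  fixes r :: "'i \<Rightarrow> 'b::linorder"
  assumes "finite I" and "k \<le> card I"
  shows "card {j\<in>I. k \<le> card {i\<in>I. r i < r j}} + k \<le> card I"
proof (cases "{j\<in>I. k \<le> card {i\<in>I. r i < r j}} = {}")
  case True
  show ?thesis unfolding True using assms by simp
next
  case False
  define J where "J = {j\<in>I. k \<le> card {i\<in>I. r i < r j}}"
  have "finite J" "J \<noteq> {}" using False assms by (auto simp: J_def)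
  then obtain j where j: "j \<in> J" "\<And>i. i \<in> J \<Longrightarrow> r j \<le> r i"
    using arg_min_if_finite(1)[of J r] arg_min_least[of J _ r] by blast
  define L where "L = {i\<in>I. r i < r j}"
  have "J \<inter> L = {}" using j(2) by (force simp: L_def)
  then have "card J + card L = card (J \<union> L)"
    using \<open>finite J\<close> assms by (simp add: L_def card_Un_disjoint)
  also have "\<dots> \<le> card I" using assms by (intro card_mono) (auto simp: J_def L_def)
  finally show ?thesis using j(1) by (auto simp: J_def L_def)
qed

text \<open>The entries below \<open>x\<close> form an initial segment of a sorted list, and
  position \<open>n\<close>, counted from 0, lies in it exactly when its length exceeds
  \<open>n\<close>.\<close>

lemma sorted_nth_less_iff:
  fixes x :: "'b::linorder"
  assumes "sorted xs" and "n < length xs"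
  shows "xs ! n < x \<longleftrightarrow> n < length (filter (\<lambda>y. y < x) xs)"
proof -
  let ?S = "{i. i < length xs \<and> xs ! i < x}"
  have len: "length (filter (\<lambda>y. y < x) xs) = card ?S"
    by (rule length_filter_conv_card)
  show ?thesis
  proof
    assume "xs ! n < x"
    then have "{..n} \<subseteq> ?S"
      using assms by (auto intro: le_less_trans sorted_nth_mono)
    then have "card {..n} \<le> card ?S" by (intro card_mono) auto
    then show "n < length (filter (\<lambda>y. y < x) xs)" by (simp add: len)
  next
    assume *: "n < length (filter (\<lambda>y. y < x) xs)"
    show "xs ! n < x"
    proof (rule ccontr)
      assume "\<not> xs ! n < x"
      then have "\<not> xs ! i < x" if "n \<le> i" "i < length xs" for i
        using sorted_nth_mono[OF assms(1) that] by simp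
      then have "?S \<subseteq> {..<n}" by (auto simp: not_le[symmetric])
      then have "card ?S \<le> card {..<n}" by (intro card_mono) auto
      then show False using * len by simp
    qed
  qed
qed

text \<open>Sorting preserves the multiset, hence the number of entries below \<open>x\<close>. The
  list position is \<open>k - 1\<close>, so \<open>1 \<le> k\<close> turns the strict bound on
  positions into \<open>k \<le> card\<close>.\<close>

lemma order_stat_less_iff:
  assumes "1 \<le> k" and "k \<le> B"
  shows "order_stat B r k < ereal x \<longleftrightarrow> k \<le> card {b\<in>{1..B}. r b < x}"
proof -
  let ?xs = "map r [1..<B + 1]"
  have "length (filter (\<lambda>y. y < x) (sort ?xs)) = length (filter (\<lambda>y. y < x) ?xs)"
    by (metis mset_filter mset_sort size_mset)
  also have "\<dots> = length (filter (\<lambda>b. r b < x) [1..<B + 1])"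
    by (simp add: filter_map o_def del: upt_Suc)
  also have "\<dots> = card ({b. r b < x} \<inter> set [1..<B + 1])"
    by (rule distinct_length_filter) simp
  also have "{b. r b < x} \<inter> set [1..<B + 1] = {b\<in>{1..B}. r b < x}" by auto
  finally have "length (filter (\<lambda>y. y < x) (sort ?xs)) = card {b\<in>{1..B}. r b < x}" .
  moreover have "k - 1 < length (sort ?xs)" using assms by simp
  ultimately show ?thesis
    using sorted_nth_less_iff[of "sort ?xs" "k - 1" x] assms
    by (simp add: order_stat_def Suc_le_eq[symmetric] del: upt_Suc)
qed

lemma rank_ge_measurable:
  fixes r :: "'b \<Rightarrow> real"
  assumes "finite I" and "j \<in> I" and [measurable]: "r \<in> borel_measurable N"
  shows "{x \<in> space (\<Pi>\<^sub>M i\<in>I. N). k \<le> card {i\<in>I. r (x i) < r (x j)}} \<in> sets (\<Pi>\<^sub>M i\<in>I. N)"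
proof -
  have [measurable]: "(\<lambda>x. r (x i)) \<in> borel_measurable (\<Pi>\<^sub>M i\<in>I. N)" if "i \<in> I" for i
    using that by measurable
  \<comment> \<open>The cardinality becomes a finite sum of indicators, whose measurability in
    \<open>x\<close> follows from that of the comparisons.\<close>
  have "{x \<in> space (\<Pi>\<^sub>M i\<in>I. N). real k \<le> (\<Sum>i\<in>I. if r (x i) < r (x j) then 1 else 0)}
      \<in> sets (\<Pi>\<^sub>M i\<in>I. N)"
    using assms(2) by measurable
  moreover have "real (card {i\<in>I. r (x i) < r (x j)}) = (\<Sum>i\<in>I. if r (x i) < r (x j) then 1 else 0)" for x
    using assms(1) by (simp add: sum.If_cases Int_def)
  ultimately show ?thesis by (simp flip: of_nat_le_iff[where ?'a = real])
qed

text \<open>The averaging argument for an arbitrary real statistic \<open>r\<close> of exchangeable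
  variables; later \<open>r\<close> is the maximal ratio of a trajectory.\<close>

lemma exchangeable_rank_bound:
  fixes r :: "'b \<Rightarrow> real"
  assumes "prob_space P" and "exchangeable P N I X" and r: "r \<in> borel_measurable N"
    and I: "finite I" "j \<in> I" and k: "k \<le> card I"
  shows "real (card I) * measure P {\<omega>\<in>space P. k \<le> card {i\<in>I. r (X i \<omega>) < r (X j \<omega>)}}
    \<le> real (card I) - real k"
proof -
  interpret prob_space P by fact
  have X [measurable]: "X i \<in> measurable P N" if "i \<in> I" for i
    using assms(2) that by (simp add: exchangeable_def)
  define A where "A = (\<lambda>l. {\<omega>\<in>space P. k \<le> card {i\<in>I. r (X i \<omega>) < r (X l \<omega>)}})"
  define E where "E = {x \<in> space (\<Pi>\<^sub>M i\<in>I. N). k \<le> card {i\<in>I. r (x i) < r (x j)}}"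
  define Y where "Y = (\<lambda>\<pi> \<omega>. \<lambda>i\<in>I. X (\<pi> i) \<omega>)"
  have E: "E \<in> sets (\<Pi>\<^sub>M i\<in>I. N)"
    unfolding E_def using I r by (intro rank_ge_measurable)
  have Y: "Y \<pi> \<in> measurable P (\<Pi>\<^sub>M i\<in>I. N)" if "\<pi> permutes I" for \<pi>
    unfolding Y_def using that by (intro measurable_restrict X) (simp add: permutes_in_image)
  \<comment> \<open>Permuting the variables only reorders the set being counted, but moves the
    distinguished index to \<open>\<pi> j\<close>. Thus the single event \<open>E\<close> pulls back
    to every \<open>A l\<close>.\<close>
  have vim: "Y \<pi> -` E \<inter> space P = A (\<pi> j)" if \<pi>: "\<pi> permutes I" for \<pi>
  proof -
    have "card {i\<in>I. r (X (\<pi> i) \<omega>) < r (X (\<pi> j) \<omega>)} = card {i\<in>I. r (X i \<omega>) < r (X (\<pi> j) \<omega>)}" for \<omega>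
    proof (rule bij_betw_same_card[of \<pi>])
      show "bij_betw \<pi> {i\<in>I. r (X (\<pi> i) \<omega>) < r (X (\<pi> j) \<omega>)} {i\<in>I. r (X i \<omega>) < r (X (\<pi> j) \<omega>)}"
        using permutes_imp_bij[OF \<pi>] by (rule bij_betw_Collect) simp
    qed
    moreover have "{i\<in>I. r (Y \<pi> \<omega> i) < r (Y \<pi> \<omega> j)} = {i\<in>I. r (X (\<pi> i) \<omega>) < r (X (\<pi> j) \<omega>)}" for \<omega>
      using I by (auto simp: Y_def)
    ultimately show ?thesis
      using measurable_space[OF Y[OF \<pi>]] by (auto simp: E_def A_def)
  qed
  have same: "prob (A l) = prob (A j)" "A l \<in> events" if l: "l \<in> I" for l
  proof -
    let ?\<pi> = "Transposition.transpose j l"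
    have \<pi>: "?\<pi> permutes I" using I l by (simp add: permutes_swap_id)
    have "prob (A l) = measure (distr P (\<Pi>\<^sub>M i\<in>I. N) (Y ?\<pi>)) E"
      using vim[OF \<pi>] by (simp add: measure_distr[OF Y[OF \<pi>] E])
    also have "distr P (\<Pi>\<^sub>M i\<in>I. N) (Y ?\<pi>) = distr P (\<Pi>\<^sub>M i\<in>I. N) (Y id)"
      using assms(2) \<pi> by (simp add: exchangeable_def Y_def)
    also have "measure \<dots> E = prob (A j)"
      using vim[OF permutes_id] by (simp add: measure_distr[OF Y[OF permutes_id] E])
    finally show "prob (A l) = prob (A j)" .
    show "A l \<in> events"
      using measurable_sets[OF Y[OF \<pi>] E] vim[OF \<pi>] by simp
  qed
  have "real (card I) * prob (A j) = (\<Sum>l\<in>I. prob (A l))"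
    using same(1) by simp
  \<comment> \<open>The sum of probabilities is the expected number of indices \<open>l\<close> for
    which \<open>A l\<close> occurs, and \<open>card_rank_ge\<close> bounds that number
    pointwise.\<close>
  also have "\<dots> = expectation (\<lambda>\<omega>. \<Sum>l\<in>I. indicator (A l) \<omega>)"
    using same(2) by (subst Bochner_Integration.integral_sum) (auto simp: emeasure_eq_measure)
  also have "\<dots> \<le> expectation (\<lambda>\<omega>. real (card I) - real k)"
  proof (rule integral_mono)
    show "integrable P (\<lambda>\<omega>. \<Sum>l\<in>I. indicator (A l) \<omega> :: real)"
      using same(2) by (auto simp: emeasure_eq_measure)
    fix \<omega> assume "\<omega> \<in> space P"
    then have "(\<Sum>l\<in>I. indicator (A l) \<omega>) = real (card {l\<in>I. k \<le> card {i\<in>I. r (X i \<omega>) < r (X l \<omega>)}})"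
      using I by (simp add: A_def indicator_def sum.If_cases Int_def)
    with card_rank_ge[OF I(1) k, of "\<lambda>i. r (X i \<omega>)"]
    show "(\<Sum>l\<in>I. indicator (A l) \<omega>) \<le> real (card I) - real k" by linarith
  qed simp
  also have "\<dots> = real (card I) - real k" by (simp add: prob_space)
  finally show ?thesis by (simp add: A_def)
qed

text \<open>For finite \<open>q\<close>, divide by \<open>g t > 0\<close>: a maximum exceeds
  \<open>q\<close> iff one of the ratios does. For \<open>q = \<infinity>\<close>, positivity of
  \<open>g t\<close> keeps the product infinite and both sides fail.\<close>

lemma less_max_ratio_iff:
  assumes "\<And>t. t \<le> T \<Longrightarrow> 0 < g t" and "q \<noteq> -\<infinity>"
  shows "(\<exists>t\<le>T. q * ereal (g t) < ereal (M t \<omega>)) \<longleftrightarrow> q < ereal (max_ratio T g M \<omega>)"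
proof (cases q)
  case (real y)
  have "y * g t < M t \<omega> \<longleftrightarrow> y < M t \<omega> / g t" if "t \<le> T" for t
    using assms(1)[OF that] by (simp add: pos_less_divide_eq)
  then show ?thesis
    by (auto simp: real max_ratio_def Max_gr_iff)
next
  case PInf
  have "q * ereal (g t) = \<infinity>" if "t \<le> T" for t
    using assms(1)[OF that] PInf by simp
  then show ?thesis using PInf by auto
qed (use assms in auto)

text \<open>Without a crossing the infimum in \<open>enat\<close> is \<infinity>, which is above
  \<open>enat T\<close>; any crossing time in the set bounds it by \<open>T\<close>.\<close>

lemma first_crossing_le_iff:
  "first_crossing T B \<alpha> g M Mc \<omega> \<le> enat T \<longleftrightarrow>
    (\<exists>t\<le>T. q_hat T B \<alpha> g Mc \<omega> * ereal (g t) < ereal (M t \<omega>))"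
    (is "_ \<longleftrightarrow> (\<exists>t\<le>T. ?C t)")
proof
  assume *: "first_crossing T B \<alpha> g M Mc \<omega> \<le> enat T"
  show "\<exists>t\<le>T. ?C t"
  proof (rule ccontr)
    assume "\<not> (\<exists>t\<le>T. ?C t)"
    then have "{enat t | t. t \<le> T \<and> ?C t} = {}" by auto
    then have "first_crossing T B \<alpha> g M Mc \<omega> = \<infinity>"
      unfolding first_crossing_def by (simp only:) (simp add: top_enat_def)
    with * show False by simp
  qed
next
  assume "\<exists>t\<le>T. ?C t"
  then obtain t where "t \<le> T" "?C t" by auto
  then have "first_crossing T B \<alpha> g M Mc \<omega> \<le> enat t"
    unfolding first_crossing_def by (intro Inf_lower) auto
  with \<open>t \<le> T\<close> show "first_crossing T B \<alpha> g M Mc \<omega> \<le> enat T"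
    by (meson enat_ord_simps(1) order_trans)
qed

theorem theorem2p2:
  fixes P0 :: "'a measure"
    and F :: "nat \<Rightarrow> 'a measure"
    and T B :: nat
    and \<alpha> :: real
    and g :: "nat \<Rightarrow> real"
    and M :: "nat \<Rightarrow> 'a \<Rightarrow> real"
    and Mc :: "nat \<Rightarrow> nat \<Rightarrow> 'a \<Rightarrow> real"
  assumes "prob_space P0"
    and "0 < \<alpha>" and "\<alpha> < 1"
    and "\<And>t. t \<le> T \<Longrightarrow> 0 < g t"
    and "e_process P0 T F M"
    and "\<And>b. b \<in> {1..B} \<Longrightarrow>
           distr P0 (traj_space T) (traj T (Mc b)) = distr P0 (traj_space T) (traj T M)"
    and "prob_space.indep_vars P0 (\<lambda>b. traj_space T) (\<lambda>b. traj T (Mc b)) {1..B}"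
    and "exchangeable P0 (traj_space T) {0..B}
           (\<lambda>b. traj T (if b = 0 then M else Mc b))"
  shows "measure P0 {\<omega> \<in> space P0. first_crossing T B \<alpha> g M Mc \<omega> \<le> enat T} \<le> \<alpha>"
proof -
  define k where "k = k_index \<alpha> B"
  define R where "R = (\<lambda>x::nat \<Rightarrow> real. Max ((\<lambda>t. x t / g t) ` {0..T}))"
  define X where "X = (\<lambda>b. traj T (if b = 0 then M else Mc b))"
  \<comment> \<open>Positivity makes the ceiling at least 1, so \<open>nat\<close> does not truncate
    it and \<open>k\<close> is a valid rank.\<close>
  have "0 < (1 - \<alpha>) * real (B + 1)" using assms(3) by simp
  then have k: "1 \<le> k" "(1 - \<alpha>) * real (B + 1) \<le> real k"
    unfolding k_def k_index_def by linarith+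
  have R: "R \<in> borel_measurable (traj_space T)"
    unfolding R_def by (intro borel_measurable_Max) measurable
  have RX: "R (X b \<omega>) = max_ratio T g (if b = 0 then M else Mc b) \<omega>" for b \<omega>
    unfolding R_def X_def max_ratio_def traj_def by (intro arg_cong[of _ _ Max] image_cong) auto
  \<comment> \<open>The conjunct \<open>k \<le> B\<close> rules out the infinite threshold, which no
    trajectory can cross.\<close>
  have cross: "first_crossing T B \<alpha> g M Mc \<omega> \<le> enat T \<longleftrightarrow>
      k \<le> B \<and> k \<le> card {i\<in>{0..B}. R (X i \<omega>) < R (X 0 \<omega>)}" for \<omega>
  proof -
    have "first_crossing T B \<alpha> g M Mc \<omega> \<le> enat T \<longleftrightarrow> q_hat T B \<alpha> g Mc \<omega> < ereal (R (X 0 \<omega>))"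
      unfolding first_crossing_le_iff RX if_P[OF refl]
      using assms(4) by (intro less_max_ratio_iff) (auto simp: q_hat_def order_stat_def)
    also have "\<dots> \<longleftrightarrow> k \<le> B \<and> k \<le> card {i\<in>{1..B}. max_ratio T g (Mc i) \<omega> < R (X 0 \<omega>)}"
      using order_stat_less_iff[OF k(1)]
      by (cases "k \<le> B") (auto simp: q_hat_def k_def[symmetric] order_stat_def)
    \<comment> \<open>Index 0 can be added because the test statistic is not strictly below
      itself.\<close>
    also have "{i\<in>{1..B}. max_ratio T g (Mc i) \<omega> < R (X 0 \<omega>)} = {i\<in>{0..B}. R (X i \<omega>) < R (X 0 \<omega>)}"
      by (auto simp: RX Suc_le_eq split: if_splits)
    finally show ?thesis .
  qed
  show ?thesis
  proof (cases "k \<le> B")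
    case True
    have "real (B + 1) * measure P0 {\<omega> \<in> space P0. first_crossing T B \<alpha> g M Mc \<omega> \<le> enat T}
        \<le> real (B + 1) - real k"
      using exchangeable_rank_bound[OF assms(1) assms(8) R, of 0 k] True
      by (simp add: cross X_def)
    also have "\<dots> \<le> real (B + 1) * \<alpha>" using k(2) by (simp add: algebra_simps)
    finally show ?thesis by (simp del: of_nat_add of_nat_Suc)
  next
    \<comment> \<open>The threshold is infinite here, so the crossing event is empty.\<close>
    case False
    then show ?thesis using assms(2) by (simp add: cross)
  qed
qed

end
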